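(* Let $d$ and $n$ be positive integers with \[ d^2-d+1<n<d^2. \] Then there does not exist a complex $d\times n$ equiangular tight frame.
   Context: A complex $d\times n$ equiangular tight frame is a matrix $\boldsymbol{X}\in\mathbb{C}^{d\times n}$ for which there exist real numbers $\alpha,\beta>0$ such that \[ |\boldsymbol{X}^*\boldsymbol{X}|=(1-\alpha)\boldsymbol{I}+\alpha\boldsymbol{J} \qquad\text{and}\qquad \boldsymbol{X}\boldsymbol{X}^*=\beta\boldsymbol{I}. \] Here $\boldsymbol{X}^*$ is the conjugate transpose of $\boldsymbol{X}$, $|\cdot|$ denotes the entrywise absolute value (modulus) of a matrix, $\boldsymbol{I}$ is the identity matrix of the appropriate size ($n\times n$ in the first equation, $d\times d$ in the second), and $\boldsymbol{J}$ is the $n\times n$ all-ones matrix. Equivalently, the first equation says that every column of $\boldsymbol{X}$ has unit norm and that every two distinct columns have inner product of modulus $\alpha$. *)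

theory Defs
  imports "Jordan_Normal_Form.Schur_Decomposition"
begin

definition all_ones_mat :: "nat \<Rightarrow> real mat" where
  "all_ones_mat n = mat n n (\<lambda>_. 1)"

definition equiangular_tight_frame :: "nat \<Rightarrow> nat \<Rightarrow> complex mat \<Rightarrow> bool" where
  "equiangular_tight_frame d n X \<longleftrightarrow>
     X \<in> carrier_mat d n \<and>
     (\<exists>\<alpha> \<beta> :: real. \<alpha> > 0 \<and> \<beta> > 0 \<and>
        map_mat cmod (mat_adjoint X * X) = (1 - \<alpha>) \<cdot>\<^sub>m 1\<^sub>m n + \<alpha> \<cdot>\<^sub>m all_ones_mat n \<and>
        X * mat_adjoint X = complex_of_real \<beta> \<cdot>\<^sub>m 1\<^sub>m d)"

end

theory Submission
  imports Defs
begin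

text \<open>
  Let \<open>x\<^sub>0, \<dots>, x\<^sub>n\<^sub>-\<^sub>1\<close> be the columns of an equiangular tight frame in dimension
  \<open>d \<ge> 2\<close> (for \<open>d = 1\<close> the range of \<open>n\<close> is empty), and let
  \<open>P\<^sub>i = x\<^sub>i x\<^sub>i\<^sup>*\<close> be the projections onto their lines. Equiangularity makes the \<open>P\<^sub>i\<close> linearly
  independent in the \<open>d\<^sup>2\<close>-dimensional space of matrices, which gives the classical bound
  \<open>n \<le> d\<^sup>2\<close>. The gap below \<open>d\<^sup>2\<close> appears because, unless \<open>n = d\<^sup>2\<close>, there are \<open>d - 1\<close> further
  directions that are independent of all the \<open>P\<^sub>i\<close>: the rank-one matrices \<open>z x\<^sub>0\<^sup>*\<close> with
  \<open>z\<close> orthogonal to \<open>x\<^sub>0\<close>. Hence \<open>n + (d - 1) \<le> d\<^sup>2\<close>.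

  For the independence, suppose \<open>\<Sum>\<^sub>i c\<^sub>i P\<^sub>i + z x\<^sub>0\<^sup>* = 0\<close> with \<open>z \<bottom> x\<^sub>0\<close>.
  Taking the trace gives \<open>\<Sum>\<^sub>i c\<^sub>i = 0\<close>. Evaluating the quadratic form at \<open>x\<^sub>l\<close> then determines
  the coefficients: \<open>(1 - \<alpha>\<^sup>2) c\<^sub>l = - \<langle>x\<^sub>l, z\<rangle> \<langle>x\<^sub>0, x\<^sub>l\<rangle>\<close>. Applying the matrix relation to the
  vector \<open>x\<^sub>0\<close> and inserting these coefficients leaves
  \<open>(1 - \<alpha>\<^sup>2) z = \<Sum>\<^sub>i |\<langle>x\<^sub>0, x\<^sub>i\<rangle>|\<^sup>2 \<langle>x\<^sub>i, z\<rangle> x\<^sub>i = \<alpha>\<^sup>2 \<beta> z\<close>, where equiangularity,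
  tightness and \<open>\<langle>x\<^sub>0, z\<rangle> = 0\<close> were used. So \<open>z = 0\<close> unless \<open>\<alpha>\<^sup>2 (1 + \<beta>) = 1\<close>.
  Since \<open>\<beta> = n / d\<close> and \<open>\<beta> = 1 + (n - 1) \<alpha>\<^sup>2\<close>, that exceptional equation
  forces \<open>n = d\<^sup>2\<close> (lemma \<open>size_forces_multiplier_nonzero\<close>). The independence is lemma
  \<open>projections_and_rank_ones_independent\<close>.
\<close>

section \<open>Underdetermined linear systems\<close>

text \<open>
  Arbitrary finite index sets allow the equations and the unknowns below to be indexed by pairs and
  by a disjoint sum. The coefficient matrix becomes square and singular when a zero row is appended,
  followed by arbitrary rows.
\<close>

lemma underdetermined_homogeneous_system:
  fixes a :: "'e \<Rightarrow> 'j \<Rightarrow> 'a :: field"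
  assumes "finite E" and "finite J" and "card E < card J"
  obtains c where "\<exists>j\<in>J. c j \<noteq> 0" and "\<And>e. e \<in> E \<Longrightarrow> (\<Sum>j\<in>J. a e j * c j) = 0"
proof -
  define m where "m = card E"
  define N where "N = card J"
  obtain eqn where eqn: "bij_betw eqn {0..<m} E"
    using ex_bij_betw_nat_finite[OF assms(1)] m_def by auto
  obtain unk where unk: "bij_betw unk {0..<N} J"
    using ex_bij_betw_nat_finite[OF assms(2)] N_def by auto
  have mN: "m < N" using assms(3) by (simp add: m_def N_def)
  define M where "M = mat\<^sub>r N N (\<lambda>r. if r = m then 0\<^sub>v N else vec N (\<lambda>j. a (eqn r) (unk j)))"
  have M: "M \<in> carrier_mat N N" by (simp add: M_def)
  have "det M = 0" unfolding M_def by (rule det_row_0[OF mN]) auto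
  then obtain v where v: "v \<in> carrier_vec N" "v \<noteq> 0\<^sub>v N" "M *\<^sub>v v = 0\<^sub>v N"
    using det_0_iff_vec_prod_zero_field[OF M] by auto
  define c where "c j = v $ (inv_into {0..<N} unk j)" for j
  have c_unk: "c (unk j) = v $ j" if "j < N" for j
    using unk that by (simp add: c_def bij_betw_def)
  show thesis
  proof
    obtain j where "j < N" "v $ j \<noteq> 0" using v(1,2) by (auto simp: vec_eq_iff)
    then show "\<exists>j\<in>J. c j \<noteq> 0"
      using c_unk unk by (metis atLeast0LessThan bij_betwE lessThan_iff)
  next
    fix e assume "e \<in> E"
    then obtain r where r: "r < m" "e = eqn r"
      using eqn by (metis atLeast0LessThan bij_betw_iff_bijections lessThan_iff)
    have "(\<Sum>j\<in>J. a e j * c j) = (\<Sum>j=0..<N. a e (unk j) * c (unk j))"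
      by (rule sum.reindex_bij_betw[OF unk, symmetric])
    also have "\<dots> = (\<Sum>j=0..<N. a e (unk j) * v $ j)"
      by (simp add: c_unk)
    also have "\<dots> = (M *\<^sub>v v) $ r"
      using r mN v(1) by (auto simp: M_def mat_of_rows_def scalar_prod_def intro!: sum.cong)
    also have "\<dots> = 0" using v(3) r mN by simp
    finally show "(\<Sum>j\<in>J. a e j * c j) = 0" .
  qed
qed

section \<open>Independence of the projections and certain rank-one matrices\<close>

text \<open>
  Here \<open>x p i\<close> is coordinate \<open>p\<close> of vector \<open>i\<close>. The conditions are the entries of the two
  defining matrix equations of an equiangular tight frame.
\<close>
locale tight_equiangular_vectors =
  fixes d n :: nat and x :: "nat \<Rightarrow> nat \<Rightarrow> complex" and \<alpha> \<beta> :: real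
  assumes unit: "i < n \<Longrightarrow> (\<Sum>p<d. cnj (x p i) * x p i) = 1"
    and equiangular: "\<lbrakk>i < n; l < n; i \<noteq> l\<rbrakk> \<Longrightarrow> cmod (\<Sum>p<d. cnj (x p i) * x p l) = \<alpha>"
    and tight: "\<lbrakk>p < d; q < d\<rbrakk> \<Longrightarrow> (\<Sum>i<n. x p i * cnj (x q i)) = (if p = q then \<beta> else 0)"
begin

definition gram :: "nat \<Rightarrow> nat \<Rightarrow> complex" where
  "gram i l = (\<Sum>p<d. cnj (x p i) * x p l)"

lemma gram_diag: "i < n \<Longrightarrow> gram i i = 1"
  by (simp add: gram_def unit)

lemma gram_mult_swap:
  assumes "i < n" "l < n"
  shows "gram i l * gram l i = \<alpha>\<^sup>2 + (if l = i then 1 - \<alpha>\<^sup>2 else 0)"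
proof (cases "i = l")
  case False
  have "gram l i = cnj (gram i l)" by (simp add: gram_def mult.commute)
  moreover have "cmod (gram i l) = \<alpha>"
    using equiangular[OF assms False] by (simp add: gram_def)
  ultimately show ?thesis using False
    using complex_norm_square[of "gram i l"] by simp
qed (use assms in \<open>simp add: gram_diag\<close>)

text \<open>
  The matrix of squared moduli of inner products is \<open>(1 - \<alpha>\<^sup>2) I + \<alpha>\<^sup>2 J\<close>. This is the Gram
  matrix of the projections \<open>P\<^sub>i\<close>, and it is used as an operator on vectors \<open>u\<close>.
\<close>
lemma sum_gram_mult_swap:
  fixes u :: "nat \<Rightarrow> complex"
  assumes "l < n"
  shows "(\<Sum>i<n. u i * (gram l i * gram i l)) = \<alpha>\<^sup>2 * (\<Sum>i<n. u i) + (1 - \<alpha>\<^sup>2) * u l"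
proof -
  have "(\<Sum>i<n. u i * (gram l i * gram i l)) =
        (\<Sum>i<n. \<alpha>\<^sup>2 * u i + (if i = l then (1 - \<alpha>\<^sup>2) * u i else 0))"
    by (rule sum.cong) (auto simp: gram_mult_swap assms algebra_simps)
  also have "\<dots> = \<alpha>\<^sup>2 * (\<Sum>i<n. u i) + (1 - \<alpha>\<^sup>2) * u l"
    using assms by (simp add: sum.distrib sum_distrib_left sum.delta)
  finally show ?thesis .
qed

text \<open>The operator form of tightness: \<open>\<Sum>\<^sub>i \<langle>x\<^sub>i, z\<rangle> x\<^sub>i = \<beta> z\<close>.\<close>
lemma reconstruction:
  fixes z :: "nat \<Rightarrow> complex"
  assumes "p < d"
  shows "(\<Sum>i<n. x p i * (\<Sum>q<d. cnj (x q i) * z q)) = \<beta> * z p"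
proof -
  have "(\<Sum>i<n. x p i * (\<Sum>q<d. cnj (x q i) * z q))
      = (\<Sum>q<d. (\<Sum>i<n. x p i * cnj (x q i)) * z q)"
    unfolding sum_distrib_left sum_distrib_right
    by (subst sum.swap) (simp add: mult.assoc)
  also have "\<dots> = (\<Sum>q<d. if p = q then \<beta> * z q else 0)"
    using assms by (intro sum.cong) (auto simp: tight)
  also have "\<dots> = \<beta> * z p" using assms by simp
  finally show ?thesis .
qed

text \<open>Both sides are the trace of \<open>\<Sum>\<^sub>i P\<^sub>i = \<beta> I\<close>.\<close>
lemma frame_constant: "real d * \<beta> = real n"
proof -
  have "complex_of_real (real d * \<beta>) = (\<Sum>p<d. \<Sum>i<n. x p i * cnj (x p i))"
    by (simp add: tight)
  also have "\<dots> = (\<Sum>i<n. \<Sum>p<d. cnj (x p i) * x p i)"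
    by (subst sum.swap) (simp add: mult.commute)
  also have "\<dots> = complex_of_real (real n)" by (simp add: unit)
  finally show ?thesis using of_real_eq_iff by blast
qed

text \<open>
  Both sides evaluate \<open>\<Sum>\<^sub>i |\<langle>x\<^sub>0, x\<^sub>i\<rangle>|\<^sup>2\<close>, on the left by tightness and on the right by
  equiangularity. Together with \<open>d \<beta> = n\<close> this is the case of equality in the Welch bound.
\<close>
lemma welch_equality:
  assumes "n > 0"
  shows "\<beta> = 1 + (real n - 1) * \<alpha>\<^sup>2"
proof -
  have "complex_of_real \<beta> = \<beta> * (\<Sum>p<d. cnj (x p 0) * x p 0)" using assms by (simp add: unit)
  also have "\<dots> = (\<Sum>p<d. cnj (x p 0) * (\<Sum>i<n. x p i * gram i 0))"
    by (simp add: gram_def reconstruction mult.left_commute flip: sum_distrib_left)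
  also have "\<dots> = (\<Sum>p<d. \<Sum>i<n. cnj (x p 0) * x p i * gram i 0)"
    by (simp add: sum_distrib_left mult.assoc)
  also have "\<dots> = (\<Sum>i<n. \<Sum>p<d. cnj (x p 0) * x p i * gram i 0)"
    by (rule sum.swap)
  also have "\<dots> = (\<Sum>i<n. 1 * (gram 0 i * gram i 0))"
    by (simp add: gram_def[of 0] sum_distrib_right)
  also have "\<dots> = complex_of_real (1 + (real n - 1) * \<alpha>\<^sup>2)"
    using assms by (subst sum_gram_mult_swap) (auto simp: algebra_simps)
  finally show ?thesis using of_real_eq_iff by blast
qed

text \<open>
  This makes the coefficients \<open>c\<^sub>l\<close> recoverable from \<open>(1 - \<alpha>\<^sup>2) c\<^sub>l\<close>. If all vectors were on one
  line, they could form a tight frame only in dimension one.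
\<close>
lemma not_all_parallel:
  assumes "d \<ge> 2" and "n > 0"
  shows "\<alpha>\<^sup>2 \<noteq> 1"
proof
  assume "\<alpha>\<^sup>2 = 1"
  then have "\<beta> = real n" using welch_equality assms by simp
  then show False using frame_constant assms by simp
qed

text \<open>
  The number \<open>1 - \<alpha>\<^sup>2 (1 + \<beta>)\<close> is the factor that multiplies \<open>z\<close> at the end of the independence
  argument. If it vanished, then \<open>\<beta>\<^sup>2 = n\<close>, and \<open>d \<beta> = n\<close> would give \<open>n = d\<^sup>2\<close>.
\<close>
lemma size_forces_multiplier_nonzero:
  assumes "n > 0" and "n \<noteq> d\<^sup>2"
  shows "\<alpha>\<^sup>2 * (1 + \<beta>) \<noteq> 1"
proof
  assume *: "\<alpha>\<^sup>2 * (1 + \<beta>) = 1"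
  have "(\<beta> - 1) * (1 + \<beta>) = (real n - 1) * (\<alpha>\<^sup>2 * (1 + \<beta>))"
    using welch_equality[OF assms(1)] by simp
  then have "(\<beta> - 1) * (1 + \<beta>) = real n - 1" unfolding * by simp
  then have "\<beta>\<^sup>2 = real n" by (simp add: algebra_simps power2_eq_square)
  then have "real n * real n = real d ^ 2 * real n"
    using frame_constant by (metis power2_eq_square power_mult_distrib)
  then have "real n = real (d\<^sup>2)" using assms(1) by simp
  then show False using assms(2) of_nat_eq_iff by blast
qed

text \<open>
  The hypothesis \<open>rel\<close> is the matrix relation \<open>\<Sum>\<^sub>i c\<^sub>i P\<^sub>i + z x\<^sub>0\<^sup>* = 0\<close>, entry by entry. It
  determines \<open>c\<close> in terms of \<open>z\<close>, and turns into an eigenvalue equation for \<open>z\<close>. Without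
  orthogonality the relation \<open>P\<^sub>0 - x\<^sub>0 x\<^sub>0\<^sup>* = 0\<close> would be a counterexample.
\<close>
lemma projections_and_rank_ones_independent:
  assumes "d \<ge> 2" and "n > 0" and "n \<noteq> d\<^sup>2"
    and rel: "\<And>p q. \<lbrakk>p < d; q < d\<rbrakk> \<Longrightarrow> (\<Sum>i<n. c i * (x p i * cnj (x q i))) + z p * cnj (x q 0) = 0"
    and orth: "(\<Sum>p<d. cnj (x p 0) * z p) = 0"
  shows "\<And>p. p < d \<Longrightarrow> z p = 0" and "\<And>i. i < n \<Longrightarrow> c i = 0"
proof -
  define h where "h i = (\<Sum>p<d. cnj (x p i) * z p)" for i
  have h0: "h 0 = 0" using orth by (simp add: h_def)
  have \<alpha>1: "(1 - complex_of_real (\<alpha>\<^sup>2)) \<noteq> 0"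
    using not_all_parallel[OF assms(1,2)] by (metis eq_iff_diff_eq_0 of_real_1 of_real_eq_iff)
  have trace: "(\<Sum>i<n. c i) = 0"
  proof -
    have "0 = (\<Sum>p<d. (\<Sum>i<n. c i * (x p i * cnj (x p i))) + z p * cnj (x p 0))"
      by (simp add: rel)
    also have "\<dots> = (\<Sum>i<n. c i * gram i i) + h 0"
      unfolding sum.distrib gram_def h_def sum_distrib_left
      by (subst sum.swap) (simp add: mult_ac)
    finally show ?thesis by (simp add: h0 gram_diag)
  qed
  \<comment> \<open>The quadratic form of the relation at \<open>x\<^sub>l\<close>; the all-ones part of the Gram matrix of the
      projections drops out because the coefficients sum to zero.\<close>
  have against: "(1 - \<alpha>\<^sup>2) * c l + h l * gram 0 l = 0" if l: "l < n" for l
  proof -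
    have "0 = (\<Sum>p<d. \<Sum>q<d. cnj (x p l) * x q l *
                ((\<Sum>i<n. c i * (x p i * cnj (x q i))) + z p * cnj (x q 0)))"
      by (simp add: rel)
    also have "\<dots> = (\<Sum>p<d. \<Sum>q<d. \<Sum>i<n. c i * (cnj (x p l) * x p i * (cnj (x q i) * x q l)))
                  + (\<Sum>p<d. \<Sum>q<d. cnj (x p l) * z p * (cnj (x q 0) * x q l))"
      by (simp add: sum.distrib distrib_left sum_distrib_left mult_ac)
    also have "(\<Sum>p<d. \<Sum>q<d. cnj (x p l) * z p * (cnj (x q 0) * x q l)) = h l * gram 0 l"
      by (simp add: h_def gram_def sum_product)
    also have "(\<Sum>p<d. \<Sum>q<d. \<Sum>i<n. c i * (cnj (x p l) * x p i * (cnj (x q i) * x q l)))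
             = (\<Sum>p<d. \<Sum>i<n. \<Sum>q<d. c i * (cnj (x p l) * x p i * (cnj (x q i) * x q l)))"
      by (intro sum.cong refl sum.swap)
    also have "\<dots> = (\<Sum>i<n. \<Sum>p<d. \<Sum>q<d. c i * (cnj (x p l) * x p i * (cnj (x q i) * x q l)))"
      by (rule sum.swap)
    also have "\<dots> = (\<Sum>i<n. c i * (gram l i * gram i l))"
      unfolding gram_def sum_product by (simp add: sum_distrib_left)
    also have "\<dots> = (1 - \<alpha>\<^sup>2) * c l" using sum_gram_mult_swap[OF l, of c] trace by simp
    finally show ?thesis by simp
  qed
  \<comment> \<open>The relation as an operator, applied to \<open>x\<^sub>0\<close>.\<close>
  have apply_first: "(\<Sum>i<n. c i * gram i 0 * x p i) + z p = 0" if p: "p < d" for p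
  proof -
    have "0 = (\<Sum>q<d. ((\<Sum>i<n. c i * (x p i * cnj (x q i))) + z p * cnj (x q 0)) * x q 0)"
      by (simp add: rel p)
    also have "\<dots> = (\<Sum>q<d. \<Sum>i<n. c i * (x p i * (cnj (x q i) * x q 0))) + z p * gram 0 0"
      unfolding gram_def distrib_right sum.distrib sum_distrib_left sum_distrib_right
      by (simp add: mult.assoc)
    also have "(\<Sum>q<d. \<Sum>i<n. c i * (x p i * (cnj (x q i) * x q 0)))
             = (\<Sum>i<n. c i * gram i 0 * x p i)"
      by (subst sum.swap) (simp add: gram_def sum_distrib_left sum_distrib_right mult_ac)
    finally show ?thesis using assms(2) by (simp add: gram_diag)
  qed
  show z: "z p = 0" if p: "p < d" for p
  proof -
    have "(\<Sum>i<n. (1 - \<alpha>\<^sup>2) * c i * gram i 0 * x p i) = - ((1 - \<alpha>\<^sup>2) * z p)"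
      using apply_first[OF p] 
      by (simp add: sum_distrib_left[symmetric] mult.assoc add_eq_0_iff)
    \<comment> \<open>Multiplied by \<open>1 - \<alpha>\<^sup>2\<close>, each coefficient can be replaced through \<open>against\<close>.\<close>
    moreover have "(1 - \<alpha>\<^sup>2) * c i * gram i 0 * x p i = - (h i * x p i * (gram 0 i * gram i 0))"
      if "i < n" for i
    proof -
      have coefficient: "(1 - \<alpha>\<^sup>2) * c i = - (h i * gram 0 i)"
        using against[OF that] by (simp add: eq_neg_iff_add_eq_0)
      show ?thesis unfolding coefficient by (simp add: mult_ac)
    qed
    ultimately have "(\<Sum>i<n. h i * x p i * (gram 0 i * gram i 0)) = (1 - \<alpha>\<^sup>2) * z p"
      by (simp add: sum_negf)
    moreover have "(\<Sum>i<n. h i * x p i) = \<beta> * z p"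
      using reconstruction[OF p, of z] by (simp add: h_def mult.commute)
    ultimately have "\<alpha>\<^sup>2 * (\<beta> * z p) = (1 - \<alpha>\<^sup>2) * z p"
      using sum_gram_mult_swap[OF assms(2), of "\<lambda>i. h i * x p i"] h0 by simp
    then have "(complex_of_real (\<alpha>\<^sup>2 * (1 + \<beta>)) - 1) * z p = 0"
      by (simp add: algebra_simps)
    then show ?thesis
      using size_forces_multiplier_nonzero[OF assms(2,3)]
      by (metis eq_iff_diff_eq_0 mult_eq_0_iff of_real_1 of_real_eq_iff)
  qed
  show "c i = 0" if "i < n" for i
    using against[OF that] z \<alpha>1 by (simp add: h_def)
qed

text \<open>
  If the bound failed, the unknowns \<open>(c, z)\<close>, which are \<open>n + d\<close> in number, would satisfy the
  \<open>d\<^sup>2\<close> entries of the matrix relation and the single orthogonality condition non-trivially.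
\<close>
theorem size_bound:
  assumes "d \<ge> 2" and "n > 0" and "n \<noteq> d\<^sup>2"
  shows "n + d \<le> d\<^sup>2 + 1"
proof (rule ccontr)
  assume contra: "\<not> n + d \<le> d\<^sup>2 + 1"
  \<comment> \<open>\<open>None\<close> indexes the orthogonality condition and \<open>Some (p, q)\<close> entry \<open>(p, q)\<close> of the relation;
      \<open>Inl i\<close> indexes \<open>c\<^sub>i\<close> and \<open>Inr p\<close> coordinate \<open>p\<close> of \<open>z\<close>.\<close>
  define E where "E = insert None (Some ` ({..<d} \<times> {..<d}))"
  define J :: "(nat + nat) set" where "J = {..<n} <+> {..<d}"
  define a where "a e j = (case e of
      None \<Rightarrow> (case j of Inl i \<Rightarrow> 0 | Inr p \<Rightarrow> cnj (x p 0))
    | Some (p, q) \<Rightarrow> (case j of Inl i \<Rightarrow> x p i * cnj (x q i)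
                             | Inr r \<Rightarrow> if r = p then cnj (x q 0) else 0))" for e j
  have "card E = d\<^sup>2 + 1"
    by (simp add: E_def card_image power2_eq_square)
  moreover have "card J = n + d" by (simp add: J_def card_Plus)
  ultimately have "card E < card J" using contra by simp
  moreover have "finite E" "finite J" by (simp_all add: E_def J_def)
  ultimately obtain v where nonzero: "\<exists>j\<in>J. v j \<noteq> 0"
    and sol: "\<And>e. e \<in> E \<Longrightarrow> (\<Sum>j\<in>J. a e j * v j) = 0"
    using underdetermined_homogeneous_system[of E J a] by metis
  have split: "(\<Sum>j\<in>J. f j) = (\<Sum>i<n. f (Inl i)) + (\<Sum>p<d. f (Inr p))" for f :: "_ \<Rightarrow> complex"
    unfolding J_def by (simp add: sum.Plus)
  have rel: "(\<Sum>i<n. v (Inl i) * (x p i * cnj (x q i))) + v (Inr p) * cnj (x q 0) = 0"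
    if "p < d" "q < d" for p q
  proof -
    have "(\<Sum>r<d. a (Some (p, q)) (Inr r) * v (Inr r)) =
          (\<Sum>r<d. if r = p then v (Inr r) * cnj (x q 0) else 0)"
      by (rule sum.cong) (auto simp: a_def)
    then show ?thesis
      using sol[of "Some (p, q)"] that by (simp add: E_def split) (simp add: a_def mult_ac)
  qed
  have orth: "(\<Sum>p<d. cnj (x p 0) * v (Inr p)) = 0"
    using sol[of None] by (simp add: E_def split a_def)
  note zero = projections_and_rank_ones_independent
    [OF assms, of "\<lambda>i. v (Inl i)" "\<lambda>p. v (Inr p)", OF rel orth]
  show False using nonzero zero by (auto simp: J_def)
qed

end

section \<open>Equiangular tight frames as matrices\<close>

lemma equiangular_tight_frame_columns:
  assumes "equiangular_tight_frame d n X"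
  obtains \<alpha> \<beta> where "tight_equiangular_vectors d n (\<lambda>p i. X $$ (p, i)) \<alpha> \<beta>"
proof -
  from assms obtain \<alpha> \<beta> :: real where X: "X \<in> carrier_mat d n"
    and gram: "map_mat cmod (mat_adjoint X * X) = (1 - \<alpha>) \<cdot>\<^sub>m 1\<^sub>m n + \<alpha> \<cdot>\<^sub>m all_ones_mat n"
    and tight: "X * mat_adjoint X = complex_of_real \<beta> \<cdot>\<^sub>m 1\<^sub>m d"
    unfolding equiangular_tight_frame_def by blast
  have adj: "mat_adjoint X \<in> carrier_mat n d" and
    adj_entry: "\<And>p i. p < d \<Longrightarrow> i < n \<Longrightarrow> mat_adjoint X $$ (i, p) = cnj (X $$ (p, i))"
    using X by (auto simp: mat_adjoint_def mat_of_rows_def)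
  have cmod_entry: "cmod (\<Sum>p<d. cnj (X $$ (p, i)) * X $$ (p, l)) = (if i = l then 1 else \<alpha>)"
    if "i < n" "l < n" for i l
  proof -
    have "(mat_adjoint X * X) $$ (i, l) = (\<Sum>p<d. cnj (X $$ (p, i)) * X $$ (p, l))"
      using X adj that by (auto simp: scalar_prod_def adj_entry atLeast0LessThan intro!: sum.cong)
    moreover have "map_mat cmod (mat_adjoint X * X) $$ (i, l) = (if i = l then 1 else \<alpha>)"
      unfolding gram using that by (simp add: all_ones_mat_def)
    ultimately show ?thesis using X adj that by simp
  qed
  show thesis
  proof (rule that, unfold_locales)
    fix i assume i: "i < n"
    \<comment> \<open>The frame equation only fixes the modulus of a diagonal Gram entry; being a sum of squares,
        that entry is real and nonnegative, so it equals its modulus.\<close>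
    have "(\<Sum>p<d. cnj (X $$ (p, i)) * X $$ (p, i)) = of_real (\<Sum>p<d. (cmod (X $$ (p, i)))\<^sup>2)"
      unfolding of_real_sum complex_norm_square by (simp add: mult.commute)
    moreover from this have "(\<Sum>p<d. (cmod (X $$ (p, i)))\<^sup>2) = 1"
      using cmod_entry[OF i i] by (simp add: sum_nonneg del: of_real_sum)
    ultimately show "(\<Sum>p<d. cnj (X $$ (p, i)) * X $$ (p, i)) = 1" by simp
  next
    fix i l assume "i < n" "l < n" "i \<noteq> l"
    then show "cmod (\<Sum>p<d. cnj (X $$ (p, i)) * X $$ (p, l)) = \<alpha>" using cmod_entry by simp
  next
    fix p q assume pq: "p < d" "q < d"
    have "(\<Sum>i<n. X $$ (p, i) * cnj (X $$ (q, i))) = (X * mat_adjoint X) $$ (p, q)"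
      using X adj pq by (auto simp: scalar_prod_def adj_entry atLeast0LessThan intro!: sum.cong)
    then show "(\<Sum>i<n. X $$ (p, i) * cnj (X $$ (q, i))) = (if p = q then \<beta> else 0)"
      using pq by (simp add: tight)
  qed
qed

theorem theorem1:
  fixes d n :: nat
  assumes "d > 0" and "n > 0"
    and "d\<^sup>2 - d + 1 < n" and "n < d\<^sup>2"
  shows "\<not> (\<exists>X :: complex mat. equiangular_tight_frame d n X)"
proof
  assume "\<exists>X :: complex mat. equiangular_tight_frame d n X"
  then obtain X \<alpha> \<beta> where "tight_equiangular_vectors d n (\<lambda>p i. X $$ (p, i)) \<alpha> \<beta>"
    using equiangular_tight_frame_columns by metis
  moreover have "d \<ge> 2"
  proof (rule ccontr)
    assume "\<not> d \<ge> 2"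
    then have "d = 1" using assms(1) by simp
    then show False using assms(3,4) by simp
  qed
  ultimately have "n + d \<le> d\<^sup>2 + 1"
    using tight_equiangular_vectors.size_bound assms(2,4) by blast
  then show False using assms(3) by linarith
qed

end
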